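(* Let $\mathbb{F}$ be any field, let $G=([n],E)$ be a directed graph, $\mathcal{S}_G=\langle\mathrm{E}_{i,j}\mid (i,j)\in E\rangle\le\mathrm{M}(n,\mathbb{F})$, and $r\in\{0,1,\dots,n\}$. Then $G$ is $r$-acyclic if and only if every matrix $B\in\mathcal{S}_G$ has at least $r$ zero eigenvalues (i.e. its characteristic polynomial is divisible by $x^r$).
   Context: Directed graph: $E\subseteq[n]\times[n]$, self-loops allowed (a self-loop is a cycle of length $1$). $G$ is $r$-acyclic if every collection of pairwise vertex-disjoint directed cycles of $G$ covers at most $n-r$ vertices. $\mathrm{E}_{i,j}$ is the elementary matrix with $1$ at $(i,j)$. *)

theory Defs
  imports
    "Graph_Theory.Pair_Digraph"
    "Jordan_Normal_Form.Char_Poly"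
    "Jordan_Normal_Form.VS_Connect"
begin

(* JNF matrices are indexed from 0, so the vertex set [n] = {1,...,n} is rendered as {0..<n}. *)
definition digraph_on :: "nat \<Rightarrow> (nat \<times> nat) set \<Rightarrow> nat pair_pre_digraph" where
  "digraph_on n E = \<lparr>pverts = {0..<n}, parcs = E\<rparr>"

definition cycle_verts :: "('a \<times> 'a) list \<Rightarrow> 'a set" where
  "cycle_verts p = fst ` set p \<union> snd ` set p"

(* Cycles are those of Graph_Theory: nonempty closed arc lists without repeated vertices, where a
   self-loop [(v, v)] counts. Rotations of one cycle are different lists, but they share their
   vertices, so a vertex-disjoint collection contains at most one of them.
   The bound card - r is written additively to avoid truncated subtraction. *)
definition r_acyclic :: "nat \<Rightarrow> 'a pair_pre_digraph \<Rightarrow> bool" where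
  "r_acyclic r G \<longleftrightarrow>
     (\<forall>C. (\<forall>p\<in>C. pre_digraph.cycle (with_proj G) p) \<and>
          pairwise (\<lambda>p q. disjnt (cycle_verts p) (cycle_verts q)) C \<longrightarrow>
          card (\<Union>p\<in>C. cycle_verts p) + r \<le> card (pverts G))"

definition elementary_mat :: "nat \<Rightarrow> nat \<Rightarrow> nat \<Rightarrow> 'a :: zero_neq_one mat" where
  "elementary_mat n i j = mat n n (\<lambda>(k, l). if k = i \<and> l = j then 1 else 0)"

definition graph_mat_space :: "nat \<Rightarrow> (nat \<times> nat) set \<Rightarrow> 'a :: field mat set" where
  "graph_mat_space n E =
     module.span class_ring (module_mat TYPE('a) n n) {elementary_mat n i j | i j. (i, j) \<in> E}"

end

theory Submission
  imports Defs "HOL-Combinatorics.Orbits"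
begin

text \<open>
  A vertex-disjoint family of cycles covering \<open>U\<close> is the same as a permutation of \<open>U\<close> that moves
  every vertex along an arc. In the Leibniz expansion of the characteristic polynomial of \<open>B\<close>, the
  term of a permutation \<open>p\<close> vanishes unless \<open>p\<close> follows arcs on the set \<open>U\<close> of all \<open>i\<close> that are
  moved or satisfy \<open>(i, i) \<in> E\<close>, and it is divisible by \<open>x ^ (n - card U)\<close>. Conversely, if \<open>B\<close> is the
  permutation matrix of \<open>s\<close> on \<open>U\<close>, extended by zero, then the characteristic polynomial is
  \<open>x ^ (n - card U) * q\<close>, and only \<open>p = s\<close> contributes to \<open>q(0)\<close>, which is therefore \<open>1\<close> or \<open>-1\<close>.
\<close>

section \<open>Disjoint cycles and permutations\<close>

text \<open>The definition of a cycle only makes the heads of its arcs distinct. Closedness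
  transfers this to the tails: each vertex of a cycle has exactly one arc leaving it and one
  entering it.\<close>

lemma cycle_with_projD:
  assumes "pre_digraph.cycle (with_proj G) p"
  shows "set p \<subseteq> parcs G" "inj_on fst (set p)" "inj_on snd (set p)"
    "fst ` set p = cycle_verts p" "snd ` set p = cycle_verts p"
proof -
  obtain u where walk: "pre_digraph.awalk (with_proj G) u p u"
    and dist: "distinct (tl (pre_digraph.awalk_verts (with_proj G) u p))" and "p \<noteq> []"
    using assms unfolding pre_digraph.cycle_def by blast
  have cas: "pre_digraph.cas (with_proj G) u p u" and arcs: "set p \<subseteq> parcs G"
    using walk unfolding pre_digraph.awalk_def by simp_all
  have last: "snd (last p) = v" if "pre_digraph.cas (with_proj G) u p v" "p \<noteq> []" for u v p
    using that by (induction p arbitrary: u) (auto simp: pre_digraph.cas.simps)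
  have "fst (hd p) = u"
    using cas \<open>p \<noteq> []\<close> pre_digraph.cas_simp[of p "with_proj G" u u] by simp
  then have snd: "pre_digraph.awalk_verts (with_proj G) u p = u # map snd p"
    using pre_digraph.awalk_verts_conv'[OF cas] \<open>p \<noteq> []\<close> by simp
  have "pre_digraph.awalk_verts (with_proj G) u p = map fst p @ [u]"
    using last[OF cas \<open>p \<noteq> []\<close>] \<open>p \<noteq> []\<close> pre_digraph.awalk_verts_conv[of "with_proj G" u p]
    by simp
  \<comment> \<open>The walk is closed, so its vertex list is both the tails followed by
    \<open>u\<close> and \<open>u\<close> followed by the heads. Cancelling \<open>u\<close> shows
    that tails and heads agree as multisets.\<close>
  then have "mset (map fst p @ [u]) = mset (u # map snd p)"
    using snd by simp
  then have mset: "mset (map fst p) = mset (map snd p)"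
    by simp
  have ds: "distinct (map snd p)"
    using dist snd by simp
  then have df: "distinct (map fst p)"
    using mset mset_eq_imp_distinct_iff by blast
  have "fst ` set p = snd ` set p"
    using mset_eq_setD[OF mset] by simp
  then show "fst ` set p = cycle_verts p" "snd ` set p = cycle_verts p"
    by (auto simp: cycle_verts_def)
  show "set p \<subseteq> parcs G" "inj_on fst (set p)" "inj_on snd (set p)"
    using arcs ds df by (auto simp: distinct_map)
qed

text \<open>On the union \<open>A\<close> of all arcs of the cycles, tail and head are both
  injective: within one cycle by \<open>cycle_with_projD\<close>, across cycles by disjointness.
  Both have image \<open>U\<close>, so going from tail to head is a bijection of
  \<open>U\<close>.\<close>

lemma disjoint_cycles_imp_permutes:
  assumes cyc: "\<And>p. p \<in> C \<Longrightarrow> pre_digraph.cycle (with_proj G) p"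
    and disj: "pairwise (\<lambda>p q. disjnt (cycle_verts p) (cycle_verts q)) C"
  obtains s where "s permutes (\<Union>p\<in>C. cycle_verts p)"
    and "\<And>v. v \<in> (\<Union>p\<in>C. cycle_verts p) \<Longrightarrow> (v, s v) \<in> parcs G"
proof -
  define A where "A = (\<Union>p\<in>C. set p)"
  define U where "U = (\<Union>p\<in>C. cycle_verts p)"
  \<comment> \<open>\<open>s\<close> follows the unique arc of \<open>A\<close> that leaves
    \<open>v\<close>; outside \<open>U\<close> it is the identity, as \<open>permutes\<close>
    demands.\<close>
  define s where "s v = (if v \<in> U then snd (the_inv_into A fst v) else v)" for v
  have same: "p = q" if "p \<in> C" "q \<in> C" "v \<in> cycle_verts p" "v \<in> cycle_verts q" for p q v
    using disj that unfolding pairwise_def disjnt_def by blast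
  have inj: "inj_on fst A" "inj_on snd A"
  proof -
    show "inj_on fst A"
    proof (rule inj_onI)
      fix a b assume "a \<in> A" "b \<in> A" and eq: "fst a = fst b"
      then obtain p q where pq: "p \<in> C" "q \<in> C" "a \<in> set p" "b \<in> set q"
        by (auto simp: A_def)
      then have "p = q"
        using same[of p q "fst a"] eq unfolding cycle_verts_def by (metis UnI1 imageI)
      then show "a = b"
        using pq eq cycle_with_projD(2)[OF cyc] by (auto dest: inj_onD)
    qed
    show "inj_on snd A"
    proof (rule inj_onI)
      fix a b assume "a \<in> A" "b \<in> A" and eq: "snd a = snd b"
      then obtain p q where pq: "p \<in> C" "q \<in> C" "a \<in> set p" "b \<in> set q"
        by (auto simp: A_def)
      then have "p = q"
        using same[of p q "snd a"] eq unfolding cycle_verts_def by (metis UnI2 imageI)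
      then show "a = b"
        using pq eq cycle_with_projD(3)[OF cyc] by (auto dest: inj_onD)
    qed
  qed
  have img: "fst ` A = U" "snd ` A = U"
    using cycle_with_projD(4,5)[OF cyc] by (auto simp: A_def U_def image_UN)
  have "bij_betw (the_inv_into A fst) U A"
    using bij_betw_the_inv_into[of fst A U] inj img by (simp add: bij_betw_def)
  moreover have "bij_betw snd A U"
    using inj img by (simp add: bij_betw_def)
  ultimately have "bij_betw (snd \<circ> the_inv_into A fst) U U"
    by (rule bij_betw_trans)
  then have "bij_betw s U U"
    by (rule bij_betw_cong[THEN iffD1, rotated]) (simp add: s_def)
  then have "s permutes U"
    by (rule bij_imp_permutes) (simp add: s_def)
  moreover have "(v, s v) \<in> parcs G" if "v \<in> U" for v
  proof -
    have "v \<in> fst ` A"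
      using that img by simp
    then have "the_inv_into A fst v \<in> A" "fst (the_inv_into A fst v) = v"
      using the_inv_into_into[OF inj(1) _ subset_refl] f_the_inv_into_f[OF inj(1)] by auto
    then have "(v, s v) \<in> A"
      using that by (metis prod.collapse s_def)
    then show ?thesis
      using cycle_with_projD(1)[OF cyc] by (auto simp: A_def)
  qed
  ultimately show thesis
    using that unfolding U_def by blast
qed

lemma cyclic_on_imp_cycle:
  assumes "cyclic_on s c" "c \<subseteq> pverts G" "\<And>v. v \<in> c \<Longrightarrow> (v, s v) \<in> parcs G"
  obtains p where "pre_digraph.cycle (with_proj G) p" "cycle_verts p = c"
proof -
  obtain x where x: "x \<in> c" "c = orbit s x"
    using assms(1) unfolding cyclic_on_def by blast
  \<comment> \<open>\<open>m\<close> is the first positive return time of \<open>x\<close>. A fixed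
    point has \<open>m = 1\<close> and yields a self-loop.\<close>
  define m where "m = funpow_dist1 s x x"
  define arc where "arc i = ((s ^^ i) x, (s ^^ Suc i) x)" for i
  define p where "p = map arc [0..<m]"
  have xx: "x \<in> orbit s x"
    using x by simp
  have m: "(s ^^ m) x = x" "m > 0"
    unfolding m_def using funpow_dist1_prop[OF xx] by simp_all
  have c: "c = (\<lambda>i. (s ^^ i) x) ` {0..<m}"
    unfolding m_def x(2) by (rule orbit_conv_funpow_dist1[OF xx])
  have inj: "inj_on (\<lambda>i. (s ^^ i) x) {0..<m}"
    unfolding m_def by (rule inj_on_funpow_dist1[OF xx])
  \<comment> \<open>The start \<open>i\<close> is kept general because the induction strips the
    first arc and thereby shifts the start.\<close>
  have cas: "pre_digraph.cas (with_proj G) ((s ^^ i) x) (map arc [i..<i + k]) ((s ^^ (i + k)) x)"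
    for i k
  proof (induction k arbitrary: i)
    case 0
    show ?case by (simp add: pre_digraph.cas.simps)
  next
    case (Suc k)
    show ?case
      using Suc.IH[of "Suc i"] by (simp add: pre_digraph.cas.simps arc_def upt_conv_Cons del: upt_Suc)
  qed
  have casp: "pre_digraph.cas (with_proj G) x p x"
    using cas[of 0 m] m(1) by (simp add: p_def)
  have fst: "fst ` set p = c"
    unfolding c p_def by (simp add: arc_def image_image)
  have "distinct (map fst p)"
    using inj by (simp add: p_def arc_def comp_def distinct_map)
  have ne: "p \<noteq> []"
    using m by (simp add: p_def)
  have verts: "pre_digraph.awalk_verts (with_proj G) x p = x # map snd p"
    using pre_digraph.awalk_verts_conv'[OF casp] ne m(2)
    by (simp add: p_def arc_def hd_map)
  \<comment> \<open>The last head is \<open>(s ^^ m) x\<close>, which is \<open>x\<close> again, so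
    the heads are the tails rotated by one place and inherit their distinctness.\<close>
  have "map snd p @ [] = map (\<lambda>i. (s ^^ i) x) [Suc 0..<Suc m]"
    by (simp add: p_def arc_def comp_def map_Suc_upt[symmetric] del: upt_Suc)
  also have "\<dots> = map (\<lambda>i. (s ^^ i) x) [Suc 0..<m] @ [x]"
    using m by simp
  finally have snd: "map snd p = map (\<lambda>i. (s ^^ i) x) [Suc 0..<m] @ [x]"
    by simp
  have mset: "mset (map fst p) = mset (map snd p)"
    unfolding snd using m(2) by (simp add: p_def arc_def comp_def upt_conv_Cons)
  have dist: "distinct (map snd p)"
    using \<open>distinct (map fst p)\<close> mset_eq_imp_distinct_iff[OF mset] by simp
  have snd_fst: "snd ` set p = fst ` set p"
    using mset_eq_setD[OF mset] by simp
  have "pre_digraph.awalk (with_proj G) x p x"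
    unfolding pre_digraph.awalk_def
  proof (intro conjI)
    show "set p \<subseteq> arcs (with_proj G)"
      using assms(3) unfolding c by (auto simp: p_def arc_def)
  qed (use casp x assms(2) in auto)
  then have "pre_digraph.cycle (with_proj G) p"
    unfolding pre_digraph.cycle_def using dist verts ne by auto
  moreover have "cycle_verts p = c"
    using fst snd_fst by (simp add: cycle_verts_def)
  ultimately show thesis
    using that by blast
qed

text \<open>The cycles are the orbits of \<open>s\<close> on \<open>U\<close>. Fixed points in
  \<open>U\<close> count as orbits, and the arc hypothesis supplies their self-loops.\<close>

lemma permutes_imp_disjoint_cycles:
  assumes "s permutes U" "finite U" "U \<subseteq> pverts G" and arcs: "\<And>v. v \<in> U \<Longrightarrow> (v, s v) \<in> parcs G"
  obtains C where "\<And>p. p \<in> C \<Longrightarrow> pre_digraph.cycle (with_proj G) p"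
    and "pairwise (\<lambda>p q. disjnt (cycle_verts p) (cycle_verts q)) C"
    and "(\<Union>p\<in>C. cycle_verts p) = U"
proof -
  obtain D where D: "\<forall>c\<in>D. cyclic_on s c" "\<Union>D = U"
    and disj: "\<forall>c\<in>D. \<forall>d\<in>D. c \<noteq> d \<longrightarrow> c \<inter> d = {}"
    using permutes_decompose[OF assms(1,2)] by (elim exE conjE)
  have "\<exists>p. pre_digraph.cycle (with_proj G) p \<and> cycle_verts p = c" if "c \<in> D" for c
  proof -
    have "cyclic_on s c" "c \<subseteq> U"
      using that D by auto
    then show ?thesis
      using cyclic_on_imp_cycle[of s c G] assms(3) arcs by (metis subset_iff)
  qed
  then obtain f where f: "\<And>c. c \<in> D \<Longrightarrow> pre_digraph.cycle (with_proj G) (f c)"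
      "\<And>c. c \<in> D \<Longrightarrow> cycle_verts (f c) = c"
    by metis
  show thesis
  proof
    show "pairwise (\<lambda>p q. disjnt (cycle_verts p) (cycle_verts q)) (f ` D)"
      using disj f(2) by (force simp: pairwise_def disjnt_def)
    show "(\<Union>p\<in>f ` D. cycle_verts p) = U"
      using f(2) D(2) by auto
  qed (use f(1) in auto)
qed

text \<open>This is the form that matches the Leibniz terms. \<open>U\<close> is quantified
  separately because \<open>s\<close> does not determine it: a fixed point with a self-loop may be
  covered or not.\<close>

lemma r_acyclic_digraph_on_iff:
  assumes "E \<subseteq> {0..<n} \<times> {0..<n}"
  shows "r_acyclic r (digraph_on n E) \<longleftrightarrow>
    (\<forall>s U. s permutes U \<and> (\<forall>v\<in>U. (v, s v) \<in> E) \<longrightarrow> card U + r \<le> n)"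
    (is "_ \<longleftrightarrow> ?R")
proof
  assume acyc: "r_acyclic r (digraph_on n E)"
  show ?R
  proof (intro allI impI)
    fix s U assume sU: "s permutes U \<and> (\<forall>v\<in>U. (v, s v) \<in> E)"
    then have "U \<subseteq> {0..<n}"
      using assms by auto
    then obtain C where "\<And>p. p \<in> C \<Longrightarrow> pre_digraph.cycle (with_proj (digraph_on n E)) p"
      "pairwise (\<lambda>p q. disjnt (cycle_verts p) (cycle_verts q)) C" "(\<Union>p\<in>C. cycle_verts p) = U"
      using sU permutes_imp_disjoint_cycles[of s U "digraph_on n E"] finite_subset[of U "{0..<n}"]
      by (auto simp: digraph_on_def)
    then show "card U + r \<le> n"
      using acyc unfolding r_acyclic_def by (auto simp: digraph_on_def)
  qed
next
  assume R: ?R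
  show "r_acyclic r (digraph_on n E)"
    unfolding r_acyclic_def
  proof (intro allI impI)
    fix C assume C: "(\<forall>p\<in>C. pre_digraph.cycle (with_proj (digraph_on n E)) p) \<and>
      pairwise (\<lambda>p q. disjnt (cycle_verts p) (cycle_verts q)) C"
    obtain s where "s permutes (\<Union>p\<in>C. cycle_verts p)"
      "\<And>v. v \<in> (\<Union>p\<in>C. cycle_verts p) \<Longrightarrow> (v, s v) \<in> parcs (digraph_on n E)"
      using disjoint_cycles_imp_permutes[of C "digraph_on n E"] C by blast
    then have "card (\<Union>p\<in>C. cycle_verts p) + r \<le> n"
      by (intro R[rule_format, of s]) (auto simp: digraph_on_def)
    then show "card (\<Union>p\<in>C. cycle_verts p) + r \<le> card (pverts (digraph_on n E))"
      by (simp add: digraph_on_def)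
  qed
qed

section \<open>The space of matrices supported on the arcs\<close>

text \<open>The right-hand side is a subspace containing the generators; conversely, a matrix in it
  is the sum of its entries on arcs times the corresponding elementary matrices.\<close>

lemma graph_mat_space_eq:
  assumes "E \<subseteq> {0..<n} \<times> {0..<n}"
  shows "(graph_mat_space n E :: 'a :: field mat set) =
    {B \<in> carrier_mat n n. \<forall>i<n. \<forall>j<n. (i, j) \<notin> E \<longrightarrow> B $$ (i, j) = 0}"
    (is "_ = ?N")
proof -
  interpret matrix_vs n n "TYPE('a)" .
  define S :: "'a mat set" where "S = {elementary_mat n i j | i j. (i, j) \<in> E}"
  have space: "graph_mat_space n E = span S"
    by (simp add: graph_mat_space_def S_def)
  have S_carrier: "S \<subseteq> carrier_mat n n"
    by (auto simp: S_def elementary_mat_def)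
  have S_N: "S \<subseteq> ?N"
    by (auto simp: S_def elementary_mat_def)
  have sub: "submodule class_ring (span S) V"
    using span_is_submodule[of S] S_carrier by simp
  have "submodule class_ring ?N V"
    by (intro submodule.intro module_axioms) (auto simp: matrix_vs_simps)
  then have "span S \<subseteq> ?N"
    using span_is_subset S_N by blast
  moreover have "B \<in> span S" if B: "B \<in> ?N" for B
  proof -
    \<comment> \<open>\<open>B\<close> is rebuilt one arc at a time: its truncation to
      \<open>A\<close> starts at zero and becomes \<open>B\<close> itself at
      \<open>A = E\<close>.\<close>
    have "mat n n (\<lambda>ij. if ij \<in> A then B $$ ij else 0) \<in> span S" if "finite A" "A \<subseteq> E" for A
      using that
    proof (induction A rule: finite_induct)
      case empty
      have "mat n n (\<lambda>ij. if ij \<in> {} then B $$ ij else 0) = 0\<^sub>m n n"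
        by (intro eq_matI) auto
      then show ?case
        using span_zero by simp
    next
      case (insert a A)
      obtain i j where a: "a = (i, j)"
        by force
      let ?M = "mat n n (\<lambda>ij. if ij \<in> A then B $$ ij else 0)"
      have "elementary_mat n i j \<in> S"
        using insert.prems a by (auto simp: S_def)
      then have "elementary_mat n i j \<in> span S"
        using in_own_span[of S] S_carrier by auto
      then have "B $$ (i, j) \<cdot>\<^sub>m elementary_mat n i j \<in> span S"
        using submodule.smult_closed[OF sub] by (simp add: matrix_vs_simps)
      then have "?M + B $$ (i, j) \<cdot>\<^sub>m elementary_mat n i j \<in> span S"
        using submodule.m_closed[OF sub] insert by (simp add: matrix_vs_simps)
      moreover have "?M + B $$ (i, j) \<cdot>\<^sub>m elementary_mat n i j =
          mat n n (\<lambda>ij. if ij \<in> insert a A then B $$ ij else 0)"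
        using insert.hyps a by (intro eq_matI) (auto simp: elementary_mat_def)
      ultimately show ?case
        by simp
    qed
    moreover have "finite E"
      using assms finite_subset by blast
    moreover have "mat n n (\<lambda>ij. if ij \<in> E then B $$ ij else 0) = B"
      using B by (intro eq_matI) auto
    ultimately show ?thesis
      by fastforce
  qed
  ultimately show ?thesis
    unfolding space by blast
qed

section \<open>The Leibniz expansion of the characteristic polynomial\<close>

text \<open>The variable enters the term of \<open>p\<close> only at fixed points of
  \<open>p\<close>, so powers of x can be counted term by term.\<close>

lemma char_poly_Leibniz:
  assumes "B \<in> carrier_mat n n"
  shows "char_poly B = (\<Sum>p | p permutes {0..<n}. signof p *
    (\<Prod>i = 0..<n. (if p i = i then [:0, 1:] else 0) - [:B $$ (i, p i):]))"
proof -
  have "char_poly_matrix B $$ (i, p i) = (if p i = i then [:0, 1:] else 0) - [:B $$ (i, p i):]"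
    if "p permutes {0..<n}" "i \<in> {0..<n}" for p i
    using assms that permutes_in_image[OF that(1), of i] by (auto simp: char_poly_matrix_def)
  then show ?thesis
    unfolding char_poly_def det_def'[OF char_poly_matrix_closed[OF assms]]
    by (intro sum.cong arg_cong2[where f = "(*)"] prod.cong) auto
qed

lemma X_power_dvd_char_poly:
  fixes B :: "'a :: field mat"
  assumes B: "B \<in> carrier_mat n n" "\<And>i j. i < n \<Longrightarrow> j < n \<Longrightarrow> (i, j) \<notin> E \<Longrightarrow> B $$ (i, j) = 0"
    and bound: "\<And>s U. s permutes U \<Longrightarrow> U \<subseteq> {0..<n} \<Longrightarrow> (\<And>v. v \<in> U \<Longrightarrow> (v, s v) \<in> E) \<Longrightarrow>
      card U + r \<le> n"
  shows "[:0, 1:] ^ r dvd char_poly B"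
  unfolding char_poly_Leibniz[OF B(1)]
proof (intro dvd_sum dvd_mult)
  fix p assume "p \<in> {p. p permutes {0..<n}}"
  then have p: "p permutes {0..<n}"
    by simp
  let ?f = "\<lambda>i. (if p i = i then [:0, 1:] else 0) - [:B $$ (i, p i):]"
  define U where "U = {i \<in> {0..<n}. (i, p i) \<in> E}"
  have p_less: "p i < n" if "i < n" for i
    using permutes_in_image[OF p, of i] that by simp
  show "[:0, 1:] ^ r dvd (\<Prod>i = 0..<n. ?f i)"
  proof (cases "\<exists>i<n. p i \<noteq> i \<and> (i, p i) \<notin> E")
    case True
    then obtain i where i: "i < n" "p i \<noteq> i" "(i, p i) \<notin> E"
      by blast
    then have "?f i = 0"
      using B(2) p_less by simp
    then have "(\<Prod>i = 0..<n. ?f i) = 0"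
      using i(1) by (intro prod_zero bexI[of _ i]) simp_all
    then show ?thesis
      by (simp only: dvd_0_right)
  next
    case False
    \<comment> \<open>With no vanishing factor of this kind, every index that does not follow an arc
      is fixed, so \<open>p\<close> restricts to a permutation of \<open>U\<close> and
      \<open>bound\<close> applies.\<close>
    then have fix_out: "p i = i" if "i \<notin> U" for i
      using that permutes_not_in[OF p, of i] by (cases "i < n") (auto simp: U_def)
    then have "p permutes U"
      by (rule permutes_superset[OF p]) simp
    then have "card U + r \<le> n"
      by (rule bound) (auto simp: U_def)
    moreover have U: "U \<subseteq> {0..<n}"
      by (auto simp: U_def)
    ultimately have "r \<le> card ({0..<n} - U)"
      by (simp add: card_Diff_subset finite_subset)
    then have "[:0, 1:] ^ r dvd [:0, 1 :: 'a:] ^ card ({0..<n} - U)"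
      by (rule le_imp_power_dvd)
    also have "\<dots> = (\<Prod>i\<in>{0..<n} - U. ?f i)"
    proof -
      \<comment> \<open>Here \<open>i\<close> is fixed but has no self-loop, so the diagonal entry
        of \<open>B\<close> is zero and the factor is exactly x.\<close>
      have "?f i = [:0, 1:]" if "i \<in> {0..<n} - U" for i
        using that fix_out[of i] B(2)[of i "p i"] by (auto simp: U_def)
      then show ?thesis
        by simp
    qed
    also have "\<dots> dvd (\<Prod>i = 0..<n. ?f i)"
      by (rule prod_dvd_prod_subset) auto
    finally show ?thesis .
  qed
qed

lemma char_poly_partial_permutation_mat:
  fixes s :: "nat \<Rightarrow> nat"
  assumes s: "s permutes U" and U: "U \<subseteq> {0..<n}"
  obtains q :: "'a :: field poly" where "poly q 0 \<noteq> 0"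
    and "char_poly (mat n n (\<lambda>(i, j). if i \<in> U \<and> j = s i then 1 else 0)) =
      [:0, 1:] ^ (n - card U) * q"
proof -
  let ?B = "mat n n (\<lambda>(i, j). if i \<in> U \<and> j = s i then 1 else 0) :: 'a mat"
  let ?f = "\<lambda>p i. (if p i = i then [:0, 1:] else 0) - [:?B $$ (i, p i):] :: 'a poly"
  \<comment> \<open>\<open>q\<close> is the Leibniz expansion of the characteristic polynomial of
    the block of \<open>?B\<close> on \<open>U\<close>.\<close>
  define q where "q = (\<Sum>p | p permutes U. signof p * (\<Prod>i\<in>U. ?f p i))"
  have finU: "finite U"
    using U finite_subset by blast
  have B: "?B $$ (i, p i) = (if i \<in> U \<and> p i = s i then 1 else 0)"
    if "p permutes {0..<n}" "i < n" for p i
    using that permutes_in_image[OF that(1), of i] by simp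
  have "char_poly ?B = (\<Sum>p | p permutes {0..<n}. signof p * (\<Prod>i = 0..<n. ?f p i))"
    by (rule char_poly_Leibniz) simp
  also have "\<dots> = (\<Sum>p | p permutes U. signof p * (\<Prod>i = 0..<n. ?f p i))"
  proof (rule sum.mono_neutral_right)
    \<comment> \<open>Such a \<open>p\<close> moves some index outside \<open>U\<close>, where the
      row of \<open>?B\<close> is zero, so it picks a zero off-diagonal factor.\<close>
    show "\<forall>p\<in>{p. p permutes {0..<n}} - {p. p permutes U}. signof p * (\<Prod>i = 0..<n. ?f p i) = 0"
    proof
      fix p assume "p \<in> {p. p permutes {0..<n}} - {p. p permutes U}"
      then have p: "p permutes {0..<n}" "\<not> p permutes U"
        by auto
      then obtain i where i: "i \<in> {0..<n} - U" "p i \<noteq> i"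
        using permutes_superset[OF p(1)] by blast
      then have "?f p i = 0"
        using B[OF p(1), of i] by simp
      then have "(\<Prod>i = 0..<n. ?f p i) = 0"
        using i by (intro prod_zero) auto
      then show "signof p * (\<Prod>i = 0..<n. ?f p i) = 0"
        by simp
    qed
  qed (use U in \<open>auto intro: permutes_subset simp: finite_permutations\<close>)
  also have "\<dots> = (\<Sum>p | p permutes U. [:0, 1:] ^ (n - card U) * (signof p * (\<Prod>i\<in>U. ?f p i)))"
  proof (rule sum.cong[OF refl])
    fix p assume "p \<in> {p. p permutes U}"
    then have p: "p permutes U"
      by simp
    then have "?f p i = [:0, 1:]" if "i \<in> {0..<n} - U" for i
      using that B[OF permutes_subset[OF p U], of i] permutes_not_in[OF p, of i] by simp
    then have "(\<Prod>i\<in>{0..<n} - U. ?f p i) = [:0, 1:] ^ (n - card U)"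
      using U finU by (simp add: card_Diff_subset)
    then have "(\<Prod>i = 0..<n. ?f p i) = [:0, 1:] ^ (n - card U) * (\<Prod>i\<in>U. ?f p i)"
      using prod.subset_diff[OF U, of "?f p"] by simp
    then show "signof p * (\<Prod>i = 0..<n. ?f p i) =
        [:0, 1:] ^ (n - card U) * (signof p * (\<Prod>i\<in>U. ?f p i))"
      by (simp only: mult.left_commute)
  qed
  also have "\<dots> = [:0, 1:] ^ (n - card U) * q"
    unfolding q_def by (rule sum_distrib_left[symmetric])
  finally have char: "char_poly ?B = [:0, 1:] ^ (n - card U) * q" .
  have poly_signof: "poly (signof p) 0 = (signof p :: 'a)" for p :: "nat \<Rightarrow> nat"
    by (simp add: sign_def)
  \<comment> \<open>At x = 0 the factor is minus the matrix entry, whether or not \<open>p\<close>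
    fixes \<open>i\<close>.\<close>
  have poly_f: "poly (?f p i) 0 = (if p i = s i then - 1 else 0)" if "p permutes U" "i \<in> U" for p i
    using B[OF permutes_subset[OF that(1) U], of i] that U by auto
  have "poly q 0 = (\<Sum>p | p permutes U. signof p * (\<Prod>i\<in>U. if p i = s i then - 1 else 0))"
    unfolding q_def poly_sum poly_mult poly_prod poly_signof
    by (intro sum.cong refl arg_cong2[where f = "(*)"] prod.cong)
      (rule poly_f, simp_all only: mem_Collect_eq)
  also have "\<dots> = (\<Sum>p\<in>{s}. signof p * (\<Prod>i\<in>U. if p i = s i then - 1 else 0))"
  proof (rule sum.mono_neutral_right)
    show "\<forall>p\<in>{p. p permutes U} - {s}. signof p * (\<Prod>i\<in>U. if p i = s i then - 1 else 0) = (0 :: 'a)"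
    proof
      fix p assume "p \<in> {p. p permutes U} - {s}"
      then have "p permutes U" "p \<noteq> s"
        by auto
      then obtain i where i: "p i \<noteq> s i"
        by (auto simp: fun_eq_iff)
      then have "i \<in> U"
        using permutes_not_in[OF s] permutes_not_in[OF \<open>p permutes U\<close>] by metis
      then have "(\<Prod>i\<in>U. if p i = s i then - 1 else 0) = (0 :: 'a)"
        using i finU by (intro prod_zero) auto
      then show "signof p * (\<Prod>i\<in>U. if p i = s i then - 1 else 0) = (0 :: 'a)"
        by simp
    qed
  qed (use s finU in \<open>auto simp: finite_permutations\<close>)
  \<comment> \<open>The remaining term is the sign of \<open>s\<close> times a power of -1, hence
    nonzero in every characteristic.\<close>
  also have "\<dots> \<noteq> 0"
    by (simp add: sign_def)
  finally show thesis
    using that char by blast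
qed

theorem theorem4p4:
  fixes n r :: nat and E :: "(nat \<times> nat) set"
  assumes "E \<subseteq> {0..<n} \<times> {0..<n}"
    and "r \<le> n"
  shows "r_acyclic r (digraph_on n E) \<longleftrightarrow>
    (\<forall>B \<in> (graph_mat_space n E :: 'a :: field mat set). [:0, 1:] ^ r dvd char_poly B)"
proof
  assume "r_acyclic r (digraph_on n E)"
  then have bound: "card U + r \<le> n"
    if "s permutes U" "\<And>v. v \<in> U \<Longrightarrow> (v, s v) \<in> E" for s U
    using that unfolding r_acyclic_digraph_on_iff[OF assms(1)] by blast
  show "\<forall>B \<in> (graph_mat_space n E :: 'a mat set). [:0, 1:] ^ r dvd char_poly B"
  proof
    fix B :: "'a mat"
    assume "B \<in> graph_mat_space n E"
    then have B: "B \<in> carrier_mat n n"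
      "\<And>i j. i < n \<Longrightarrow> j < n \<Longrightarrow> (i, j) \<notin> E \<Longrightarrow> B $$ (i, j) = 0"
      unfolding graph_mat_space_eq[OF assms(1)] by blast+
    show "[:0, 1:] ^ r dvd char_poly B"
      by (rule X_power_dvd_char_poly[OF B bound])
  qed
next
  assume dvd: "\<forall>B \<in> (graph_mat_space n E :: 'a mat set). [:0, 1:] ^ r dvd char_poly B"
  show "r_acyclic r (digraph_on n E)"
    unfolding r_acyclic_digraph_on_iff[OF assms(1)]
  proof (intro allI impI)
    fix s U assume sU: "s permutes U \<and> (\<forall>v\<in>U. (v, s v) \<in> E)"
    then have U: "U \<subseteq> {0..<n}"
      using assms(1) by auto
    let ?B = "mat n n (\<lambda>(i, j). if i \<in> U \<and> j = s i then 1 else 0) :: 'a mat"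
    obtain q where q: "poly q 0 \<noteq> 0" "char_poly ?B = [:0, 1:] ^ (n - card U) * q"
      using char_poly_partial_permutation_mat sU U by blast
    have "?B \<in> graph_mat_space n E"
      unfolding graph_mat_space_eq[OF assms(1)] using sU by auto
    then have dvd_q: "[:0, 1:] ^ r dvd [:0, 1:] ^ (n - card U) * q"
      unfolding q(2)[symmetric] by (rule bspec[OF dvd])
    \<comment> \<open>Since \<open>q\<close> does not vanish at 0, the root 0 has multiplicity
      exactly \<open>n - card U\<close>; a larger \<open>r\<close> would force x to divide
      \<open>q\<close>.\<close>
    have "r \<le> n - card U"
    proof (rule ccontr)
      assume "\<not> r \<le> n - card U"
      then have "[:0, 1 :: 'a:] ^ Suc (n - card U) dvd [:0, 1:] ^ r"
        by (intro le_imp_power_dvd) simp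
      then have "[:0, 1:] ^ (n - card U) * [:0, 1:] dvd [:0, 1:] ^ (n - card U) * q"
        unfolding power_Suc2 using dvd_q by (rule dvd_trans)
      then have "[:0, 1:] dvd q"
        by (subst (asm) dvd_mult_cancel_left) simp
      then show False
        using q(1) poly_eq_0_iff_dvd[of q 0] by simp
    qed
    \<comment> \<open>This excludes truncation in \<open>n - card U\<close>, so the bound can be
      rewritten additively.\<close>
    moreover have "card U \<le> n"
      using card_mono[OF _ U] by simp
    ultimately show "card U + r \<le> n"
      by simp
  qed
qed

end
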